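(* Let $p\ge n\ge 1$ with $p\ge 2$, let $X\in\mathbb{R}^{n\times p}$ be a fixed matrix whose columns satisfy $\|X_j\|_2^2=n$ for $j=1,\dots,p$, and let $z_1,\dots,z_n$ be independent, continuously distributed random variables with median $0$. Let $S=X'(\mathrm{sign}(z_1),\dots,\mathrm{sign}(z_n))'\in\mathbb{R}^p$. Let $c>1$, let $\alpha\in(0,1)$, and let $A(\alpha)>0$ be a constant such that $2p^{-(A(\alpha)-1)}\le\alpha$. Then the penalty level $\lambda=c\sqrt{2A(\alpha)\,n\log p}$ satisfies $$P\left(\lambda\ge c\|S\|_\infty\right)\ge 1-\alpha .$$
   Context: $\mathrm{sign}(x)=1$ if $x>0$, $-1$ if $x<0$, and $\mathrm{sign}(0)=0$. $X'$ denotes the transpose and $\|\cdot\|_\infty$ the maximum absolute coordinate. *)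

theory Defs
  imports "HOL-Probability.Probability"
begin

(* Continuity of the distribution function, i.e. no atoms; a density is not required. *)
definition continuously_distributed :: "'a measure \<Rightarrow> ('a \<Rightarrow> real) \<Rightarrow> bool" where
  "continuously_distributed M Z \<longleftrightarrow>
     Z \<in> borel_measurable M \<and> continuous_on UNIV (cdf (distr M borel Z))"

definition is_median :: "'a measure \<Rightarrow> ('a \<Rightarrow> real) \<Rightarrow> real \<Rightarrow> bool" where
  "is_median M Z m \<longleftrightarrow>
     \<P>(\<omega> in M. Z \<omega> \<le> m) \<ge> 1 / 2 \<and> \<P>(\<omega> in M. Z \<omega> \<ge> m) \<ge> 1 / 2"

end

theory Submission
  imports Defs
begin

(* The j-th coordinate of S is a sum of n independent centred variables bounded by |X i j|.
   With t = sqrt (2 A n ln p), Hoeffding's inequality bounds P(|S j| >= t) by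
   2 exp (- A ln p) = 2 p powr (- A), and a union bound over the p coordinates gives
   2 p powr (1 - A) <= alpha. *)

text \<open>Reduces an event about \<open>infnorm\<close> to one condition per coordinate, the form
  to which a union bound applies.\<close>

lemma infnorm_cart_le_iff: "infnorm (x :: real ^ 'n) \<le> a \<longleftrightarrow> (\<forall>i. \<bar>x $ i\<bar> \<le> a)"
proof
  assume "infnorm x \<le> a"
  then show "\<forall>i. \<bar>x $ i\<bar> \<le> a"
    using component_le_infnorm_cart order_trans by blast
next
  assume "\<forall>i. \<bar>x $ i\<bar> \<le> a"
  then show "infnorm x \<le> a"
    unfolding infnorm_cart by (intro cSup_least) auto
qed

text \<open>The mass of a point is the jump of the distribution function there, so continuity
  excludes atoms.\<close>

lemma (in prob_space) prob_eq_0_continuously_distributed: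
  assumes "continuously_distributed M Z"
  shows "prob {\<omega> \<in> space M. Z \<omega> = x} = 0"
proof -
  have [measurable]: "Z \<in> borel_measurable M"
    and cont: "isCont (cdf (distr M borel Z)) x"
    using assms by (auto simp: continuously_distributed_def continuous_on_eq_continuous_at)
  interpret D: real_distribution "distr M borel Z"
    by simp
  have "measure (distr M borel Z) {x} = 0"
    using cont by (simp add: D.isCont_cdf)
  then show ?thesis
    by (simp add: measure_distr vimage_def Int_def conj_commute)
qed

text \<open>With no atom at 0, the weak inequalities in \<open>is_median\<close> carry over to the
  strict half-lines. Each of these then has mass at least 1/2, hence exactly 1/2, and the two signs
  cancel. An atom at 0 could upset this balance: mass 1/2 at 0 and 1/2 at 1 has median 0 but mean
  sign 1/2.\<close>

lemma (in prob_space) expectation_sgn_median_0: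
  assumes cont: "continuously_distributed M Z" and med: "is_median M Z 0"
  shows "expectation (\<lambda>\<omega>. sgn (Z \<omega>)) = 0"
proof -
  have [measurable]: "Z \<in> borel_measurable M"
    using cont by (simp add: continuously_distributed_def)
  define P where "P = {\<omega> \<in> space M. Z \<omega> > 0}"
  define N where "N = {\<omega> \<in> space M. Z \<omega> < 0}"
  define Z0 where "Z0 = {\<omega> \<in> space M. Z \<omega> = 0}"
  have sets [measurable]: "P \<in> events" "N \<in> events" "Z0 \<in> events"
    unfolding P_def N_def Z0_def by measurable
  have null: "prob Z0 = 0"
    unfolding Z0_def by (rule prob_eq_0_continuously_distributed[OF cont])
  have "prob (P \<union> Z0) = prob P + prob Z0" "prob (N \<union> Z0) = prob N + prob Z0"
    "prob (P \<union> N) = prob P + prob N"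
    by (auto intro!: finite_measure_Union simp: sets P_def N_def Z0_def[symmetric])
       (auto simp: Z0_def)
  moreover have "{\<omega> \<in> space M. Z \<omega> \<ge> 0} = P \<union> Z0" "{\<omega> \<in> space M. Z \<omega> \<le> 0} = N \<union> Z0"
    by (auto simp: P_def N_def Z0_def)
  ultimately have "prob P \<ge> 1 / 2" "prob N \<ge> 1 / 2" "prob P + prob N \<le> 1"
    using med null prob_le_1[of "P \<union> N"] by (auto simp: is_median_def)
  then have "prob P = prob N"
    by linarith
  \<comment> \<open>On \<open>Z0\<close> both indicators vanish, in agreement with
    \<open>sgn 0 = 0\<close>.\<close>
  have "expectation (\<lambda>\<omega>. sgn (Z \<omega>)) = expectation (\<lambda>\<omega>. indicator P \<omega> - indicator N \<omega>)"
    by (intro Bochner_Integration.integral_cong) (auto simp: P_def N_def sgn_real_def)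
  also have "\<dots> = prob P - prob N"
    using sets by (subst Bochner_Integration.integral_diff) (auto simp: emeasure_eq_measure)
  finally show ?thesis
    using \<open>prob P = prob N\<close> by simp
qed

text \<open>Hoeffding's inequality for independent centred summands. The weights \<open>x\<close>
  will be a column of \<open>X\<close>; \<open>pos\<close> keeps the denominator in the exponent
  positive.\<close>

lemma (in prob_space) weighted_sgn_sum_tail:
  fixes x :: "'n :: finite \<Rightarrow> real"
  assumes indep: "indep_vars (\<lambda>_. borel) z UNIV"
    and cont: "\<And>i. continuously_distributed M (z i)"
    and med: "\<And>i. is_median M (z i) 0"
    and t: "t \<ge> 0" and pos: "(\<Sum>i\<in>UNIV. (x i)\<^sup>2) > 0"
  shows "prob {\<omega> \<in> space M. t \<le> \<bar>\<Sum>i\<in>UNIV. x i * sgn (z i \<omega>)\<bar>}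
           \<le> 2 * exp (- t\<^sup>2 / (2 * (\<Sum>i\<in>UNIV. (x i)\<^sup>2)))"
proof -
  have "indep_vars (\<lambda>_. borel) (\<lambda>i \<omega>. x i * sgn (z i \<omega>)) UNIV"
    by (rule indep_vars_compose2[OF indep]) measurable
  \<comment> \<open>The range is symmetric and uses absolute values because the weights may have
    either sign.\<close>
  then interpret Hoeffding_ineq M UNIV "\<lambda>i \<omega>. x i * sgn (z i \<omega>)" "\<lambda>i. - \<bar>x i\<bar>" "\<lambda>i. \<bar>x i\<bar>"
      "\<Sum>i\<in>UNIV. expectation (\<lambda>\<omega>. x i * sgn (z i \<omega>))"
    by unfold_locales (auto simp: sgn_real_def)
  \<comment> \<open>Each range has length 2|x i|; the resulting factor 4 turns Hoeffding's constant
    2 into 1/2.\<close>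
  have width: "(\<Sum>i\<in>UNIV. (\<bar>x i\<bar> - - \<bar>x i\<bar>)\<^sup>2) = 4 * (\<Sum>i\<in>UNIV. (x i)\<^sup>2)"
    by (simp add: sum_distrib_left power_mult_distrib flip: mult_2)
  have mean: "(\<Sum>i\<in>UNIV. expectation (\<lambda>\<omega>. x i * sgn (z i \<omega>))) = 0"
    by (simp add: expectation_sgn_median_0[OF cont med])
  have "prob {\<omega> \<in> space M. t \<le> \<bar>\<Sum>i\<in>UNIV. x i * sgn (z i \<omega>)\<bar>}
          \<le> 2 * exp (- 2 * t\<^sup>2 / (4 * (\<Sum>i\<in>UNIV. (x i)\<^sup>2)))"
    using Hoeffding_ineq_abs_ge[OF t] pos unfolding width mean by simp
  also have "- 2 * t\<^sup>2 / (4 * (\<Sum>i\<in>UNIV. (x i)\<^sup>2)) = - t\<^sup>2 / (2 * (\<Sum>i\<in>UNIV. (x i)\<^sup>2))"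
    using pos by (simp add: field_simps)
  finally show ?thesis .
qed

theorem lemma1:
  fixes M :: "'a measure"
    and X :: "real ^ 'p ^ 'n"
    and z :: "'n \<Rightarrow> 'a \<Rightarrow> real"
    and S :: "'a \<Rightarrow> real ^ 'p"
    and c \<alpha> A lam :: real
  assumes "CARD('p) \<ge> CARD('n)" and "CARD('n) \<ge> 1" and "CARD('p) \<ge> 2"
    and "\<And>j. (norm (column j X))\<^sup>2 = real CARD('n)"
    and "prob_space M"
    and "prob_space.indep_vars M (\<lambda>_. borel) z UNIV"
    and "\<And>i. continuously_distributed M (z i)"
    and "\<And>i. is_median M (z i) 0"
    and "S = (\<lambda>\<omega>. transpose X *v (\<chi> i. sgn (z i \<omega>)))"
    and "c > 1" and "0 < \<alpha>" and "\<alpha> < 1" and "A > 0"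
    and "2 * real CARD('p) powr (- (A - 1)) \<le> \<alpha>"
    and "lam = c * sqrt (2 * A * real CARD('n) * ln (real CARD('p)))"
  shows "\<P>(\<omega> in M. lam \<ge> c * infnorm (S \<omega>)) \<ge> 1 - \<alpha>"
proof -
  interpret prob_space M by fact
  define t where "t = sqrt (2 * A * real CARD('n) * ln (real CARD('p)))"
  define B where "B j = {\<omega> \<in> space M. t \<le> \<bar>S \<omega> $ j\<bar>}" for j
  define G where "G = {\<omega> \<in> space M. lam \<ge> c * infnorm (S \<omega>)}"
  have [measurable]: "z i \<in> borel_measurable M" for i
    using assms(7) by (simp add: continuously_distributed_def)
  have S: "S \<omega> $ j = (\<Sum>i\<in>UNIV. X $ i $ j * sgn (z i \<omega>))" for \<omega> j
    by (simp add: assms(9) matrix_vector_mult_def transpose_def)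
  have [measurable]: "(\<lambda>\<omega>. S \<omega> $ j) \<in> borel_measurable M" for j
    unfolding S by measurable
  have B [measurable]: "B j \<in> events" for j
    unfolding B_def by measurable
  \<comment> \<open>Since \<open>lam = c * t\<close> with c positive, the factor c cancels.\<close>
  have G_iff: "G = {\<omega> \<in> space M. \<forall>j. \<bar>S \<omega> $ j\<bar> \<le> t}"
    using assms(10) by (simp add: G_def assms(15) t_def infnorm_cart_le_iff)
  have G [measurable]: "G \<in> events"
    unfolding G_iff by measurable
  \<comment> \<open>The normalization of the columns makes one tail bound serve all
    coordinates.\<close>
  have col: "(\<Sum>i\<in>UNIV. (X $ i $ j)\<^sup>2) = real CARD('n)" for j
    using assms(4)[of j] by (simp add: norm_vec_def L2_set_def column_def sum_nonneg)
  have ln_pos: "ln (real CARD('p)) \<ge> 0"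
    using assms(3) by simp
  then have t2: "t\<^sup>2 = 2 * A * real CARD('n) * ln (real CARD('p))" and t0: "t \<ge> 0"
    using assms(13) by (auto simp: t_def)
  have tail: "prob (B j) \<le> 2 * real CARD('p) powr (- A)" for j
  proof -
    have "prob (B j) \<le> 2 * exp (- t\<^sup>2 / (2 * real CARD('n)))"
      unfolding B_def S
      using weighted_sgn_sum_tail[OF assms(6-8) t0, of "\<lambda>i. X $ i $ j"] by (simp add: col)
    \<comment> \<open>The factor 2n inside the square root of \<open>t\<close> is chosen to cancel
      this denominator.\<close>
    also have "- t\<^sup>2 / (2 * real CARD('n)) = - A * ln (real CARD('p))"
      by (simp add: t2)
    finally show ?thesis
      by (simp add: powr_def)
  qed
  have "1 - prob G = prob (space M - G)"
    using G by (simp add: prob_compl)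
  \<comment> \<open>Outside \<open>G\<close> some coordinate exceeds \<open>t\<close> strictly,
    while \<open>B j\<close> also allows equality, as the tail bound does; hence an
    inclusion.\<close>
  also have "\<dots> \<le> prob (\<Union>j. B j)"
    by (intro finite_measure_mono) (auto simp: G_iff B_def not_le intro: less_imp_le)
  also have "\<dots> \<le> (\<Sum>j\<in>UNIV. prob (B j))"
    by (intro finite_measure_subadditive_finite) auto
  also have "\<dots> \<le> (\<Sum>j\<in>(UNIV :: 'p set). 2 * real CARD('p) powr (- A))"
    by (intro sum_mono tail)
  \<comment> \<open>The p equal terms contribute a factor p, which raises the exponent by 1.\<close>
  also have "\<dots> = 2 * real CARD('p) powr (- (A - 1))"
    using powr_add[of "real CARD('p)" 1 "- A"] by (simp add: algebra_simps)
  also have "\<dots> \<le> \<alpha>"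
    by fact
  finally show ?thesis
    by (simp add: G_def)
qed

end
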